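(* Let $n\geq 1$ be an integer. An $n$-dimensional cube in $\mathbb{R}^n$ can be triangulated into $n!$ congruent $n$-simplices with pairwise disjoint interiors; that is, there is a triangulation of the cube whose $n$-dimensional simplices are exactly $n!$ in number, are pairwise congruent, and have pairwise disjoint interiors.
   Context: An $n$-dimensional cube ($n$-cube, hypercube) in $\mathbb{R}^n$ is an isometric copy of $[0,a]^n$ for some side length $a>0$. An $n$-simplex in $\mathbb{R}^n$ is the convex hull of $n+1$ affinely independent points. A triangulation of the cube into $n$-simplices is a finite collection of $n$-simplices whose union is the cube and such that any two of them intersect in a common face (possibly empty). Two subsets $A,B$ of $\mathbb{R}^n$ are congruent if there is an isometry $\phi$ of $\mathbb{R}^n$ with $\phi(A)=B$. *)

theory Defs
  imports "HOL-Analysis.Analysis"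
begin

definition isometry_onto ::
    "('a::metric_space \<Rightarrow> 'b::metric_space) \<Rightarrow> 'a set \<Rightarrow> 'b set \<Rightarrow> bool"
  where "isometry_onto f A B \<longleftrightarrow>
    f ` A = B \<and> (\<forall>x\<in>A. \<forall>y\<in>A. dist (f x) (f y) = dist x y)"

text \<open>The dimension \<open>n\<close> is \<open>CARD('n)\<close>, which is automatically at least 1.\<close>

definition is_cube :: "(real ^ 'n) set \<Rightarrow> bool"
  where "is_cube C \<longleftrightarrow>
    (\<exists>a>0. \<exists>f :: real ^ 'n \<Rightarrow> real ^ 'n.
       isometry_onto f {x. \<forall>i. 0 \<le> x $ i \<and> x $ i \<le> a} C)"

text \<open>The isometry is one of the whole ambient space, not merely between the two sets.\<close>

definition congruent_sets :: "'a::metric_space set \<Rightarrow> 'a set \<Rightarrow> bool"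
  where "congruent_sets A B \<longleftrightarrow>
    (\<exists>\<phi> :: 'a \<Rightarrow> 'a. isometry_onto \<phi> UNIV UNIV \<and> \<phi> ` A = B)"

text \<open>
  The library predicate \<^const>\<open>triangulation\<close> says that \<open>\<T>\<close> is a finite set of simplices, of
  arbitrary dimensions, any two of which meet in a (possibly empty) common face; here all of
  them are required to be full-dimensional.
\<close>

definition triangulates :: "(real ^ 'n) set set \<Rightarrow> (real ^ 'n) set \<Rightarrow> bool"
  where "triangulates \<T> C \<longleftrightarrow>
    triangulation \<T> \<and> (\<forall>T\<in>\<T>. int CARD('n) simplex T) \<and> \<Union>\<T> = C"

end

theory Submission
  imports Defs
begin

text \<open>
  This is the Kuhn (Freudenthal) triangulation. A bijective ranking \<open>r\<close> of the coordinates
  determines the set of points of the unit cube whose coordinates decrease along \<open>r\<close>; it is the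
  convex hull of the indicator vectors of the \<open>r\<close>-initial segments, hence a simplex. Every point of
  the cube can be sorted, so these sets cover the cube. If \<open>r\<close> and \<open>s\<close> order \<open>i\<close> and \<open>j\<close> oppositely,
  the common points satisfy \<open>x $ i = x $ j\<close>, and this gives both the face property and the
  disjointness of interiors. Permuting coordinates gives the congruences. An arbitrary cube is the
  image of the unit cube under a similarity, because a distance-preserving map defined on a
  cube extends to an affine isometry of the whole space.
\<close>

section \<open>The simplices of the unit cube\<close>

definition unit_cube :: "(real ^ 'n) set"
  where "unit_cube = {x. \<forall>i. 0 \<le> x $ i \<and> x $ i \<le> 1}"

text \<open>The index type carries no order, so permutations are encoded as bijections onto an
  initial segment of the naturals; rank 0 belongs to the largest coordinate.\<close>

definition rankings :: "('n::finite \<Rightarrow> nat) set"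
  where "rankings = {r. bij_betw r UNIV {..<CARD('n)}}"

text \<open>Inequalities rather than a convex hull, so that coordinate permutations, intersections
  and the covering property can be handled coordinatewise.\<close>

definition kuhn_simplex :: "('n \<Rightarrow> nat) \<Rightarrow> (real ^ 'n) set"
  where "kuhn_simplex r = unit_cube \<inter> {x. \<forall>i j. r i \<le> r j \<longrightarrow> x $ j \<le> x $ i}"

definition kuhn_vertex :: "('n \<Rightarrow> nat) \<Rightarrow> nat \<Rightarrow> real ^ 'n"
  where "kuhn_vertex r k = (\<chi> i. if r i < k then 1 else 0)"

section \<open>Number and congruence of the simplices\<close>

text \<open>Composing one fixed ranking \<open>e\<close> with the permutations of the index type
  yields each ranking exactly once.\<close>

lemma card_rankings: "card (rankings :: ('n::finite \<Rightarrow> nat) set) = fact CARD('n)"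
proof -
  obtain e :: "'n \<Rightarrow> nat" where e: "bij_betw e UNIV {..<CARD('n)}"
    using ex_bij_betw_finite_nat[of "UNIV :: 'n set"] by (auto simp: atLeast0LessThan)
  let ?P = "{p :: 'n \<Rightarrow> 'n. p permutes UNIV}"
  have inj: "inj_on (\<lambda>p. e \<circ> p) ?P"
    using e by (auto simp: inj_on_def bij_betw_def fun_eq_iff)
  have "(\<lambda>p. e \<circ> p) ` ?P = rankings"
  proof (intro subset_antisym subsetI)
    fix r assume "r \<in> (\<lambda>p. e \<circ> p) ` ?P"
    then show "r \<in> rankings"
      using e by (auto simp: rankings_def intro: bij_betw_trans[OF permutes_bij])
  next
    fix r :: "'n \<Rightarrow> nat" assume "r \<in> rankings"
    then have r: "bij_betw r UNIV {..<CARD('n)}" by (simp add: rankings_def)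
    let ?p = "inv_into UNIV e \<circ> r"
    have "bij ?p" using r e by (blast intro: bij_betw_trans bij_betw_inv_into)
    moreover have "r = e \<circ> ?p"
    proof
      fix i
      have "r i \<in> e ` UNIV" using r e by (auto simp: bij_betw_def)
      then show "r i = (e \<circ> ?p) i" by (simp only: o_apply f_inv_into_f)
    qed
    ultimately show "r \<in> (\<lambda>p. e \<circ> p) ` ?P" by (blast intro: bij_imp_permutes)
  qed
  then show ?thesis
    using card_image[OF inj] by (simp add: card_permutations)
qed

lemma kuhn_simplex_permute:
  fixes q :: "'n::finite \<Rightarrow> 'n"
  assumes "bij q"
  shows "(\<lambda>x. \<chi> i. x $ q i) ` kuhn_simplex r = kuhn_simplex (r \<circ> q)"
proof (intro subset_antisym subsetI)
  fix x assume "x \<in> (\<lambda>x. \<chi> i. x $ q i) ` kuhn_simplex r"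
  then show "x \<in> kuhn_simplex (r \<circ> q)"
    by (auto simp: kuhn_simplex_def unit_cube_def)
next
  fix x assume x: "x \<in> kuhn_simplex (r \<circ> q)"
  have q: "q (inv q i) = i" "inv q (q i) = i" for i
    using assms by (simp_all add: bij_is_surj surj_f_inv_f bij_is_inj)
  have "(\<chi> i. x $ inv q i) \<in> kuhn_simplex r"
    using x q by (auto simp: kuhn_simplex_def unit_cube_def)
  moreover have "x = (\<chi> i. (\<chi> i. x $ inv q i) $ q i)"
    by (simp add: q vec_eq_iff)
  ultimately show "x \<in> (\<lambda>x. \<chi> i. x $ q i) ` kuhn_simplex r" by blast
qed

lemma isometry_onto_permute:
  fixes q :: "'n::finite \<Rightarrow> 'n"
  assumes "bij q"
  shows "isometry_onto (\<lambda>x :: real ^ 'n. \<chi> i. x $ q i) UNIV UNIV"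
proof -
  have "\<exists>x :: real ^ 'n. y = (\<chi> i. x $ q i)" for y
    using assms
    by (intro exI[of _ "\<chi> i. y $ inv q i"]) (simp add: vec_eq_iff bij_is_inj)
  moreover have "dist (\<chi> i. x $ q i) (\<chi> i. y $ q i) = dist x y" for x y :: "real ^ 'n"
    using sum.reindex_bij_betw[OF assms, of "\<lambda>i. (dist (x $ i) (y $ i))\<^sup>2"]
    by (simp add: dist_vec_def L2_set_def)
  ultimately show ?thesis
    unfolding isometry_onto_def surj_def by blast
qed

text \<open>The permutation \<open>?q\<close>, the inverse of \<open>r\<close> after
  \<open>s\<close>, satisfies \<open>r \<circ> ?q = s\<close>, and permuting coordinates is an
  isometry of the whole space.\<close>

lemma congruent_kuhn_simplex:
  fixes r s :: "'n::finite \<Rightarrow> nat"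
  assumes "r \<in> rankings" "s \<in> rankings"
  shows "congruent_sets (kuhn_simplex r) (kuhn_simplex s)"
proof -
  have rs: "bij_betw r UNIV {..<CARD('n)}" "bij_betw s UNIV {..<CARD('n)}"
    using assms by (auto simp: rankings_def)
  let ?q = "inv_into UNIV r \<circ> s"
  have "bij ?q" using rs by (blast intro: bij_betw_trans bij_betw_inv_into)
  moreover have "r \<circ> ?q = s"
  proof
    fix i
    have "s i \<in> r ` UNIV" using rs by (auto simp: bij_betw_def)
    then show "(r \<circ> ?q) i = s i" by (simp only: o_apply f_inv_into_f)
  qed
  ultimately show ?thesis
    using kuhn_simplex_permute[of ?q r] isometry_onto_permute[of ?q]
    unfolding congruent_sets_def by metis
qed

section \<open>Vertices and dimension\<close>

lemma convex_kuhn_simplex: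
  fixes r :: "'n::finite \<Rightarrow> nat"
  shows "convex (kuhn_simplex r)"
proof (rule convexI)
  fix x y :: "real ^ 'n" and u v :: real
  assume xy: "x \<in> kuhn_simplex r" "y \<in> kuhn_simplex r" and u: "0 \<le> u" "0 \<le> v" "u + v = 1"
  have "u * x $ j + v * y $ j \<le> u * x $ i + v * y $ i" if "r i \<le> r j" for i j
    using xy that u by (intro add_mono mult_left_mono) (auto simp: kuhn_simplex_def)
  moreover have "0 \<le> u * x $ i + v * y $ i" "u * x $ i + v * y $ i \<le> 1" for i
    using xy u by (auto simp: kuhn_simplex_def unit_cube_def intro: convex_bound_le)
  ultimately show "u *\<^sub>R x + v *\<^sub>R y \<in> kuhn_simplex r"
    by (simp add: kuhn_simplex_def unit_cube_def)
qed

lemma kuhn_vertex_in_kuhn_simplex: "kuhn_vertex r k \<in> kuhn_simplex r"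
  by (auto simp: kuhn_simplex_def unit_cube_def kuhn_vertex_def)

text \<open>Abel summation: the weight of vertex \<open>k\<close> is the drop between two
  consecutive sorted coordinates of \<open>x\<close>.\<close>

lemma kuhn_simplex_eq_convex_hull:
  fixes r :: "'n::finite \<Rightarrow> nat"
  assumes "r \<in> rankings"
  shows "kuhn_simplex r = convex hull (kuhn_vertex r ` {..CARD('n)})"
proof (intro subset_antisym subsetI)
  fix x assume "x \<in> convex hull (kuhn_vertex r ` {..CARD('n)})"
  moreover have "convex hull (kuhn_vertex r ` {..CARD('n)}) \<subseteq> kuhn_simplex r"
    by (intro hull_minimal convex_kuhn_simplex) (auto simp: kuhn_vertex_in_kuhn_simplex)
  ultimately show "x \<in> kuhn_simplex r" by blast
next
  fix x assume x: "x \<in> kuhn_simplex r"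
  have r: "bij_betw r UNIV {..<CARD('n)}" using assms by (simp add: rankings_def)
  let ?N = "CARD('n)"
  define s where "s = inv_into UNIV r"
  have sr: "s (r i) = i" for i
    using r by (simp add: s_def bij_betw_def)
  have rs: "r (s k) = k" if "k < ?N" for k
    using r that by (simp add: s_def bij_betw_def f_inv_into_f)
  have rN: "r i < ?N" for i using r by (auto simp: bij_betw_def)
  \<comment> \<open>The coordinates of \<open>x\<close> in decreasing order, shifted by one and
    padded with 1 in front and 0 behind. The padding keeps all drops nonnegative and makes them sum
    to 1.\<close>
  define Y where "Y k = (if k = 0 then 1 else if k \<le> ?N then x $ s (k - 1) else 0)" for k
  have Y_dec: "0 \<le> Y k - Y (Suc k)" for k
    using x rs by (auto simp: Y_def kuhn_simplex_def unit_cube_def)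
  have tel: "(\<Sum>k=m..n. Y k - Y (Suc k)) = Y m - Y (Suc n)" if "m \<le> n" for m n
    using sum_Suc_diff[of m n "\<lambda>k. - Y k"] that by simp
  have "x = (\<Sum>k\<le>?N. (Y k - Y (Suc k)) *\<^sub>R kuhn_vertex r k)"
  proof (rule vec_eq_iff[THEN iffD2], rule allI)
    fix i
    have "(\<Sum>k\<le>?N. (Y k - Y (Suc k)) *\<^sub>R kuhn_vertex r k) $ i
        = (\<Sum>k\<le>?N. if r i < k then Y k - Y (Suc k) else 0)"
      by (auto simp: kuhn_vertex_def intro!: sum.cong)
    \<comment> \<open>Only the vertices with \<open>k > r i\<close> contribute to coordinate
      \<open>i\<close>; the sum telescopes to \<open>Y (Suc (r i))\<close>, which is
      \<open>x $ i\<close>.\<close>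
    also have "\<dots> = (\<Sum>k=Suc (r i)..?N. Y k - Y (Suc k))"
      by (intro sum.mono_neutral_cong_right) auto
    also have "\<dots> = x $ i"
      using tel[of "Suc (r i)" ?N] rN[of i] by (simp add: Y_def sr)
    finally show "x $ i = (\<Sum>k\<le>?N. (Y k - Y (Suc k)) *\<^sub>R kuhn_vertex r k) $ i" ..
  qed
  also have "\<dots> \<in> convex hull (kuhn_vertex r ` {..?N})"
  proof (rule convex_sum)
    show "(\<Sum>k\<le>?N. Y k - Y (Suc k)) = 1"
      by (subst sum_telescope) (simp add: Y_def)
  qed (use Y_dec in \<open>auto intro: hull_inc\<close>)
  finally show "x \<in> convex hull (kuhn_vertex r ` {..?N})" .
qed

text \<open>Affine independence by counting: consecutive vertices differ by the axis vectors and 0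
  is a vertex, so the affine dimension is full. At most \<open>Suc ?N\<close> points can achieve
  this only if they are distinct and independent.\<close>

lemma simplex_kuhn_simplex:
  fixes r :: "'n::finite \<Rightarrow> nat"
  assumes "r \<in> rankings"
  shows "int CARD('n) simplex kuhn_simplex r"
proof -
  let ?N = "CARD('n)" and ?V = "kuhn_vertex r ` {..CARD('n)}"
  have r: "bij_betw r UNIV {..<?N}" using assms by (simp add: rankings_def)
  have axis: "axis i 1 = kuhn_vertex r (Suc (r i)) - kuhn_vertex r (r i)" for i
  proof -
    have "r j < Suc (r i) \<longleftrightarrow> r j < r i \<or> j = i" for j
      using r by (auto simp: bij_betw_def inj_eq less_Suc_eq)
    then show ?thesis by (auto simp: vec_eq_iff kuhn_vertex_def axis_def)
  qed
  have "axis i 1 \<in> span ?V" for i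
  proof -
    have "r i < ?N" using r by (auto simp: bij_betw_def)
    then show ?thesis unfolding axis by (intro span_diff span_base) auto
  qed
  then have "Basis \<subseteq> span ?V" by (auto simp: Basis_vec_def)
  then have "UNIV \<subseteq> span ?V" using span_minimal[OF _ subspace_span] span_Basis by metis
  then have "dim ?V = ?N" by (simp add: dim_eq_full[THEN iffD2] top.extremum_uniqueI)
  moreover have "0 \<in> ?V"
    by (rule image_eqI[of _ _ 0]) (auto simp: vec_eq_iff kuhn_vertex_def)
  ultimately have dim: "aff_dim ?V = int ?N"
    by (simp add: aff_dim_zero hull_inc)
  moreover have "aff_dim ?V \<le> int (card ?V) - 1"
    using aff_dim_le_card[of ?V] by simp
  moreover have "card ?V \<le> Suc ?N"
    using card_image_le[of "{..?N}" "kuhn_vertex r"] by simp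
  ultimately have "int (card ?V) = int ?N + 1" by linarith
  with dim have "\<not> affine_dependent ?V"
    by (simp add: affine_independent_iff_card)
  with \<open>int (card ?V) = int ?N + 1\<close> show ?thesis
    unfolding simplex_def kuhn_simplex_eq_convex_hull[OF assms] by blast
qed

section \<open>Common faces and disjoint interiors\<close>

lemma kuhn_simplex_Int_face_of: "kuhn_simplex r \<inter> kuhn_simplex s face_of kuhn_simplex s"
  unfolding face_of_def
proof (intro conjI ballI impI)
  show "convex (kuhn_simplex r \<inter> kuhn_simplex s)"
    by (intro convex_Int convex_kuhn_simplex)
  fix a b x
  assume a: "a \<in> kuhn_simplex s" and b: "b \<in> kuhn_simplex s"
    and "x \<in> kuhn_simplex r \<inter> kuhn_simplex s" and "x \<in> open_segment a b"
  then obtain u where x: "x = (1 - u) *\<^sub>R a + u *\<^sub>R b" "x \<in> kuhn_simplex r" and u: "0 < u" "u < 1"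
    by (auto simp: in_segment)
  have *: "a $ j \<le> a $ i \<and> b $ j \<le> b $ i" if "r i \<le> r j" for i j
  proof (cases "s i \<le> s j")
    case True
    then show ?thesis using a b by (auto simp: kuhn_simplex_def)
  next
    case False
    \<comment> \<open>Here \<open>s\<close> imposes the reverse inequality on both endpoints, while
      \<open>x\<close> satisfies the one for \<open>r\<close>. A combination with positive weights
      of two nonnegative differences is then at most 0, so both vanish.\<close>
    then have "0 \<le> a $ j - a $ i" "0 \<le> b $ j - b $ i"
      using a b by (auto simp: kuhn_simplex_def)
    moreover have "x $ j \<le> x $ i" using x(2) that by (auto simp: kuhn_simplex_def)
    then have "(1 - u) * (a $ j - a $ i) + u * (b $ j - b $ i) \<le> 0"
      by (simp add: x(1) algebra_simps)
    ultimately have "(1 - u) * (a $ j - a $ i) = 0" "u * (b $ j - b $ i) = 0"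
      using u mult_nonneg_nonneg[of "1 - u" "a $ j - a $ i"]
        mult_nonneg_nonneg[of u "b $ j - b $ i"] by linarith+
    then show ?thesis using u by simp
  qed
  show "a \<in> kuhn_simplex r \<inter> kuhn_simplex s" "b \<in> kuhn_simplex r \<inter> kuhn_simplex s"
    using * a b by (auto simp: kuhn_simplex_def)
qed auto

text \<open>Without such a pair both rankings induce the same strict order, and a ranking is
  recovered from its order by counting the predecessors of each index.\<close>

lemma rankings_differ:
  fixes r s :: "'n::finite \<Rightarrow> nat"
  assumes "r \<in> rankings" "s \<in> rankings" "r \<noteq> s"
  obtains i j where "r i < r j" "s j < s i"
proof (rule ccontr)
  assume contr: "\<not> thesis"
  have bij: "bij_betw r UNIV {..<CARD('n)}" "bij_betw s UNIV {..<CARD('n)}"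
    using assms by (auto simp: rankings_def)
  have less: "s i < s j" if "r i < r j" for i j
  proof -
    have "s i \<noteq> s j" using that bij by (auto simp: bij_betw_def inj_eq)
    moreover have "\<not> s j < s i" using contr that \<open>\<And>i j. r i < r j \<Longrightarrow> s j < s i \<Longrightarrow> thesis\<close> by blast
    ultimately show ?thesis by simp
  qed
  have iff: "s i < s j \<longleftrightarrow> r i < r j" for i j
    using less[of i j] less[of j i] bij
    by (metis bij_betw_def inj_eq less_asym linorder_neqE_nat)
  have rank: "f i = card {j. f j < f i}" if "bij_betw f UNIV {..<CARD('n)}"
    for f :: "'n \<Rightarrow> nat" and i
  proof -
    have "f ` {j. f j < f i} = {..<f i}"
    proof (intro subset_antisym subsetI)
      fix k assume k: "k \<in> {..<f i}"
      moreover have "f i < CARD('n)" using that by (auto simp: bij_betw_def)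
      ultimately have "k \<in> f ` UNIV" using that by (auto simp: bij_betw_def)
      then show "k \<in> f ` {j. f j < f i}" using k by auto
    qed auto
    moreover have "inj_on f {j. f j < f i}"
      using that by (auto simp: bij_betw_def intro: inj_on_subset)
    ultimately show ?thesis using card_image by fastforce
  qed
  have "r = s" using rank[OF bij(1)] rank[OF bij(2)] by (simp add: fun_eq_iff iff)
  with assms show False by simp
qed

lemma interior_kuhn_simplex_disjoint:
  fixes r s :: "'n::finite \<Rightarrow> nat"
  assumes "r \<in> rankings" "s \<in> rankings" "r \<noteq> s"
  shows "interior (kuhn_simplex r) \<inter> interior (kuhn_simplex s) = {}"
proof -
  obtain i j where ij: "r i < r j" "s j < s i" using rankings_differ[OF assms] .
  have "x $ i = x $ j" if "x \<in> kuhn_simplex r" "x \<in> kuhn_simplex s" for x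
    using that ij by (intro antisym) (auto simp: kuhn_simplex_def)
  then have "kuhn_simplex r \<inter> kuhn_simplex s \<subseteq> {x. (axis i 1 - axis j 1) \<bullet> x = 0}"
    by (auto simp: inner_diff_left inner_axis')
  moreover have "axis i 1 - axis j (1::real) \<noteq> 0"
    using ij by (auto simp: axis_eq_axis)
  ultimately have "interior (kuhn_simplex r \<inter> kuhn_simplex s) = {}"
    using interior_mono interior_hyperplane by blast
  then show ?thesis by simp
qed

text \<open>Needed for the exact count of simplices. If \<open>r\<close> and \<open>s\<close> order
  \<open>i\<close> and \<open>j\<close> oppositely, the vertex \<open>kuhn_vertex r (r j)\<close>
  has entry 1 at \<open>i\<close> and 0 at \<open>j\<close>, which \<open>s\<close> forbids.\<close>

lemma inj_on_kuhn_simplex: "inj_on kuhn_simplex (rankings :: ('n::finite \<Rightarrow> nat) set)"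
proof (rule inj_onI, rule ccontr)
  fix r s :: "'n \<Rightarrow> nat"
  assume rs: "r \<in> rankings" "s \<in> rankings" "r \<noteq> s" "kuhn_simplex r = kuhn_simplex s"
  obtain i j where "r i < r j" "s j < s i" using rankings_differ[OF rs(1-3)] .
  moreover from this have "kuhn_vertex r (r j) $ i \<le> kuhn_vertex r (r j) $ j"
    using kuhn_vertex_in_kuhn_simplex[of r "r j", unfolded rs(4)]
    by (simp add: kuhn_simplex_def)
  ultimately show False by (simp add: kuhn_vertex_def)
qed

section \<open>Covering the unit cube\<close>

lemma Union_kuhn_simplex: "\<Union> (kuhn_simplex ` rankings) = (unit_cube :: (real ^ 'n) set)"
proof (intro subset_antisym subsetI)
  fix x :: "real ^ 'n" assume x: "x \<in> unit_cube"
  obtain e :: "'n \<Rightarrow> nat" where "inj e"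
    using ex_bij_betw_finite_nat[of "UNIV :: 'n set"] by (auto simp: bij_betw_def)
  \<comment> \<open>sort the coordinates by decreasing value, breaking ties by \<open>e\<close>\<close>
  define B where "B i = {j. x $ j > x $ i \<or> x $ j = x $ i \<and> e j < e i}" for i
  \<comment> \<open>\<open>B i\<close> collects the predecessors of \<open>i\<close> in a strict
    total order, so counting them is injective with values below \<open>CARD('n)\<close>, hence a
    ranking.\<close>
  define r where "r i = card (B i)" for i
  have sub: "B i \<subset> B j" if "i \<in> B j" for i j
    using that by (force simp: B_def)
  have less: "r i < r j" if "i \<in> B j" for i j
    unfolding r_def by (intro psubset_card_mono sub that) simp
  have tot: "i \<in> B j \<or> j \<in> B i" if "i \<noteq> j" for i j
  proof -
    have "e i \<noteq> e j" using that \<open>inj e\<close> by (simp add: inj_eq)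
    then show ?thesis by (auto simp: B_def)
  qed
  have inj: "inj r"
    by (rule injI) (use less tot in force)
  have "range r \<subseteq> {..<CARD('n)}"
  proof safe
    fix i
    have "B i \<subset> UNIV" by (auto simp: B_def)
    then show "r i < CARD('n)" unfolding r_def by (intro psubset_card_mono) auto
  qed
  then have "range r = {..<CARD('n)}"
    using inj by (intro card_subset_eq) (auto simp: card_image)
  with inj have "r \<in> rankings" by (simp add: rankings_def bij_betw_def)
  moreover have "x $ j \<le> x $ i" if "r i \<le> r j" for i j
    using less[of j i] that by (force simp: B_def)
  then have "x \<in> kuhn_simplex r" using x by (simp add: kuhn_simplex_def)
  ultimately show "x \<in> \<Union> (kuhn_simplex ` rankings)" by blast
qed (auto simp: kuhn_simplex_def)

section \<open>Transport along similarities\<close>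

text \<open>Distances are preserved only on the cube, so linearity has to be extracted from there.
  Since the cube contains 0, polarization shows that \<open>f\<close> minus \<open>f 0\<close>
  preserves inner products on it.\<close>

lemma isometry_on_cube_extends:
  fixes f :: "real ^ 'n \<Rightarrow> real ^ 'n"
  assumes "a > 0"
    and iso: "\<And>x y. x \<in> {x. \<forall>i. 0 \<le> x $ i \<and> x $ i \<le> a} \<Longrightarrow>
      y \<in> {x. \<forall>i. 0 \<le> x $ i \<and> x $ i \<le> a} \<Longrightarrow> dist (f x) (f y) = dist x y"
  obtains g where "linear g" "\<And>x. norm (g x) = norm x"
    "\<And>x. x \<in> {x. \<forall>i. 0 \<le> x $ i \<and> x $ i \<le> a} \<Longrightarrow> f x = f 0 + g x"
proof
  let ?Q = "{x :: real ^ 'n. \<forall>i. 0 \<le> x $ i \<and> x $ i \<le> a}"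
  define h where "h x = f x - f 0" for x
  have "0 \<in> ?Q" using assms by simp
  have polar: "x \<bullet> y = (norm x ^ 2 + norm y ^ 2 - norm (x - y) ^ 2) / 2" for x y :: "real ^ 'n"
    by (simp add: power2_norm_eq_inner inner_diff_left inner_diff_right inner_commute)
  have h: "h x \<bullet> h y = x \<bullet> y" if "x \<in> ?Q" "y \<in> ?Q" for x y
  proof -
    have "norm (h x) = norm x" "norm (h y) = norm y" "norm (h x - h y) = norm (x - y)"
      using iso[OF that(1) \<open>0 \<in> ?Q\<close>] iso[OF that(2) \<open>0 \<in> ?Q\<close>] iso[OF that]
      by (simp_all add: h_def dist_norm)
    then show ?thesis by (simp add: polar)
  qed
  \<comment> \<open>The linear map that agrees with \<open>h\<close> on the edge vectors
    \<open>axis i a\<close>, which lie in the cube and form a basis.\<close>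
  define g where "g x = (\<Sum>i\<in>UNIV. (x $ i / a) *\<^sub>R h (axis i a))" for x
  have ax: "axis i a \<in> ?Q" for i using assms by (auto simp: axis_def)
  have hg: "y \<bullet> g x = (\<Sum>i\<in>UNIV. x $ i / a * (y \<bullet> h (axis i a)))" for x y
    by (simp add: g_def inner_sum_right)
  have hax: "h x \<bullet> h (axis i a) = x $ i * a" if "x \<in> ?Q" for x i
    by (simp add: h[OF that ax] inner_axis)
  have hhg: "h y \<bullet> g x = y \<bullet> x" if "y \<in> ?Q" for x y
    unfolding hg hax[OF that] using \<open>a > 0\<close> by (simp add: inner_vec_def mult.commute)
  have gg: "g x \<bullet> g x = x \<bullet> x" for x
  proof -
    have "g x \<bullet> h (axis i a) = x $ i * a" for i
      using hhg[OF ax, of i x] by (simp add: inner_commute inner_axis mult.commute)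
    then have "g x \<bullet> g x = (\<Sum>i\<in>UNIV. x $ i / a * (x $ i * a))" by (simp only: hg)
    then show ?thesis using \<open>a > 0\<close> by (simp add: inner_vec_def)
  qed
  show "linear g"
    unfolding g_def
    by (intro linear_compose_sum ballI linearI)
      (simp_all add: add_divide_distrib scaleR_left_distrib)
  show "norm (g x) = norm x" for x by (simp add: norm_eq gg)
  show "f x = f 0 + g x" if "x \<in> ?Q" for x
  proof -
    \<comment> \<open>All three inner products in the expansion equal \<open>x \<bullet> x\<close>,
      so they cancel.\<close>
    have "(h x - g x) \<bullet> (h x - g x) = 0"
      using h[OF that that] hhg[OF that, of x] gg[of x]
      by (simp add: inner_diff_left inner_diff_right inner_commute)
    then have "h x = g x" by (simp only: inner_eq_zero_iff right_minus_eq)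
    then show ?thesis by (simp add: h_def algebra_simps)
  qed
qed

text \<open>The side length is absorbed into the linear part, turning the isometry into a similarity
  of ratio \<open>a\<close>.\<close>

lemma is_cube_imp_similar_unit_cube:
  fixes C :: "(real ^ 'n) set"
  assumes "is_cube C"
  obtains a c and g :: "real ^ 'n \<Rightarrow> real ^ 'n" where "a > 0" "linear g" "\<And>x. norm (g x) = a * norm x"
    "C = (\<lambda>x. c + g x) ` unit_cube"
proof -
  obtain a and f :: "real ^ 'n \<Rightarrow> real ^ 'n" where "a > 0"
    and f: "isometry_onto f {x. \<forall>i. 0 \<le> x $ i \<and> x $ i \<le> a} C"
    using assms by (auto simp: is_cube_def)
  let ?Q = "{x :: real ^ 'n. \<forall>i. 0 \<le> x $ i \<and> x $ i \<le> a}"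
  have iso: "dist (f x) (f y) = dist x y" if "x \<in> ?Q" "y \<in> ?Q" for x y
    using f that unfolding isometry_onto_def by blast
  obtain g where g: "linear g" "\<And>x. norm (g x) = norm x" "\<And>x. x \<in> ?Q \<Longrightarrow> f x = f 0 + g x"
    using isometry_on_cube_extends[OF \<open>a > 0\<close> iso] by blast
  have Q: "?Q = (*\<^sub>R) a ` unit_cube"
  proof (intro subset_antisym subsetI)
    fix x assume "x \<in> ?Q"
    then have "(1 / a) *\<^sub>R x \<in> unit_cube" "x = a *\<^sub>R ((1 / a) *\<^sub>R x)"
      using \<open>a > 0\<close> by (auto simp: unit_cube_def)
    then show "x \<in> (*\<^sub>R) a ` unit_cube" by blast
  qed (use \<open>a > 0\<close> in \<open>auto simp: unit_cube_def mult_left_le\<close>)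
  have "C = (\<lambda>x. f 0 + g x) ` ?Q"
  proof -
    have "C = f ` ?Q" using f by (simp add: isometry_onto_def)
    also have "\<dots> = (\<lambda>x. f 0 + g x) ` ?Q" by (rule image_cong[OF refl g(3)])
    finally show ?thesis .
  qed
  then have C: "C = (\<lambda>x. f 0 + (g \<circ> (*\<^sub>R) a) x) ` unit_cube"
    unfolding Q by (simp add: image_image)
  have lin: "linear (g \<circ> (*\<^sub>R) a)"
    by (intro linear_compose g) simp
  have norm: "norm ((g \<circ> (*\<^sub>R) a) x) = a * norm x" for x
    using \<open>a > 0\<close> by (simp add: g(2))
  show thesis using \<open>a > 0\<close> lin norm C by (rule that)
qed

section \<open>Injective affine images of triangulations\<close>

context
  fixes g :: "real ^ 'n \<Rightarrow> real ^ 'n" and c :: "real ^ 'n"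
  assumes lin: "linear g" and inj: "inj g"
begin

text \<open>Separates the translation from the linear map, so that the library rules for each apply
  in turn.\<close>

lemma affine_image_eq: "(\<lambda>x. c + g x) ` S = (+) c ` g ` S"
  by (simp add: image_image)

lemma simplex_affine_image:
  assumes "n simplex S"
  shows "n simplex ((\<lambda>x. c + g x) ` S)"
proof -
  obtain V where V: "finite V" "\<not> affine_dependent V" "int (card V) = n + 1" "S = convex hull V"
    using assms by (auto simp: simplex)
  let ?W = "(\<lambda>x. c + g x) ` V"
  have card: "card ?W = card V"
    by (rule card_image) (use inj in \<open>auto simp: inj_on_def\<close>)
  have "aff_dim ?W = aff_dim V"
    by (simp only: affine_image_eq aff_dim_translation_eq aff_dim_injective_linear_image[OF lin inj])
  then have "\<not> affine_dependent ?W"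
    using V card by (simp add: affine_independent_iff_card)
  moreover have "(\<lambda>x. c + g x) ` S = convex hull ?W"
    by (simp only: affine_image_eq V(4) convex_hull_linear_image[OF lin] convex_hull_translation)
  ultimately show ?thesis
    unfolding simplex_def using card V(3) by metis
qed

lemma triangulates_affine_image:
  assumes "triangulates \<T> S"
  shows "triangulates ((`) (\<lambda>x. c + g x) ` \<T>) ((\<lambda>x. c + g x) ` S)"
proof -
  have injF: "inj (\<lambda>x. c + g x)" using inj by (simp add: inj_def)
  have "(\<lambda>x. c + g x) ` T \<inter> (\<lambda>x. c + g x) ` T' face_of (\<lambda>x. c + g x) ` T"
    if "T \<in> \<T>" "T' \<in> \<T>" for T T'
  proof -
    have "T \<inter> T' face_of T"
      using assms that by (auto simp: triangulates_def triangulation_def)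
    then show ?thesis
      unfolding image_Int[OF injF, symmetric]
      by (simp only: affine_image_eq face_of_translation_eq face_of_linear_image[OF lin inj])
  qed
  moreover have "int CARD('n) simplex (\<lambda>x. c + g x) ` T" if "T \<in> \<T>" for T
    using assms that by (auto simp: triangulates_def intro: simplex_affine_image)
  ultimately show ?thesis
    using assms by (auto simp: triangulates_def triangulation_def)
qed

end

text \<open>Conjugating the isometry by \<open>F\<close> gives an isometry again, because the
  factors \<open>a\<close> of \<open>F\<close> and \<open>1 / a\<close> of its inverse
  cancel.\<close>

lemma congruent_sets_similarity_image:
  fixes F :: "'a::metric_space \<Rightarrow> 'a"
  assumes "a > 0" "bij F" and sim: "\<And>x y. dist (F x) (F y) = a * dist x y"
    and "congruent_sets S T"
  shows "congruent_sets (F ` S) (F ` T)"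
proof -
  obtain \<phi> :: "'a \<Rightarrow> 'a" where \<phi>: "surj \<phi>" "\<And>x y. dist (\<phi> x) (\<phi> y) = dist x y" "\<phi> ` S = T"
    using assms by (auto simp: congruent_sets_def isometry_onto_def)
  have inv: "inv F (F x) = x" "F (inv F x) = x" for x
    using assms(2) by (simp_all add: bij_is_inj bij_is_surj surj_f_inv_f)
  let ?\<psi> = "F \<circ> \<phi> \<circ> inv F"
  have "dist (?\<psi> x) (?\<psi> y) = dist x y" for x y
    using sim[of "inv F x" "inv F y"] by (simp add: sim \<phi> inv)
  moreover have "surj ?\<psi>"
    using \<phi>(1) assms(2) by (intro comp_surj) (auto simp: bij_is_surj bij_imp_bij_inv)
  moreover have "?\<psi> ` F ` S = F ` T"
    by (simp add: image_image inv \<phi>(3)[symmetric])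
  ultimately show ?thesis
    unfolding congruent_sets_def isometry_onto_def by blast
qed

section \<open>Triangulating an arbitrary cube\<close>

theorem theorem5:
  fixes C :: "(real ^ 'n) set"
  assumes "is_cube C"
  shows "\<exists>\<T>. triangulates \<T> C \<and>
           card \<T> = fact CARD('n) \<and>
           (\<forall>S\<in>\<T>. \<forall>T\<in>\<T>. congruent_sets S T) \<and>
           (\<forall>S\<in>\<T>. \<forall>T\<in>\<T>. S \<noteq> T \<longrightarrow> interior S \<inter> interior T = {})"
proof -
  obtain a c and g :: "real ^ 'n \<Rightarrow> real ^ 'n" where a: "a > 0" and lin: "linear g" and norm_g: "\<And>x. norm (g x) = a * norm x"
    and C: "C = (\<lambda>x. c + g x) ` unit_cube"
    using is_cube_imp_similar_unit_cube[OF assms] by metis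
  let ?F = "\<lambda>x. c + g x"
  let ?K = "kuhn_simplex ` rankings :: (real ^ 'n) set set"
  have "x = 0" if "g x = 0" for x
    using norm_g[of x] that a by simp
  then have inj: "inj g" using linear_injective_0[OF lin] by blast
  have "bij g" using inj lin by (simp add: bij_def eucl.linear_inj_imp_surj)
  then have "bij ?F"
    using bij_comp[of g "(+) c"] by (simp add: o_def)
  have "inj ?F" using \<open>bij ?F\<close> by (rule bij_is_inj)
  have sim: "dist (?F x) (?F y) = a * dist x y" for x y
    using norm_g[of "x - y"] by (simp add: dist_norm linear_diff[OF lin])
  have card: "card ?K = fact CARD('n)"
    by (simp add: card_image inj_on_kuhn_simplex card_rankings)
  have "triangulates ?K unit_cube"
    unfolding triangulates_def triangulation_def
  proof (intro conjI)
    \<comment> \<open>An infinite set would have \<open>card\<close> 0, but a factorial is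
      positive.\<close>
    show "finite ?K" by (rule card_ge_0_finite) (simp add: card)
    show "\<forall>T T'. T \<in> ?K \<and> T' \<in> ?K \<longrightarrow> T \<inter> T' face_of T"
      using kuhn_simplex_Int_face_of by (metis (no_types, lifting) Int_commute imageE)
  qed (use simplex_kuhn_simplex Union_kuhn_simplex in blast)+
  then have "triangulates ((`) ?F ` ?K) C"
    unfolding C by (rule triangulates_affine_image[OF lin inj])
  moreover have "card ((`) ?F ` ?K) = fact CARD('n)"
    using card \<open>inj ?F\<close> by (subst card_image) (auto simp: inj_on_def inj_image_eq_iff)
  moreover have "congruent_sets S T" if ST: "S \<in> (`) ?F ` ?K" "T \<in> (`) ?F ` ?K" for S T
    using ST by (auto intro!: congruent_sets_similarity_image[OF a \<open>bij ?F\<close> sim]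
        congruent_kuhn_simplex)
  moreover have "interior S \<inter> interior T = {}"
    if ST: "S \<in> (`) ?F ` ?K" "T \<in> (`) ?F ` ?K" "S \<noteq> T" for S T
  proof -
    obtain r s where r: "r \<in> rankings" "S = ?F ` kuhn_simplex r"
      and s: "s \<in> rankings" "T = ?F ` kuhn_simplex s"
      using ST by blast
    then have "r \<noteq> s" using ST by blast
    then have "interior (kuhn_simplex r) \<inter> interior (kuhn_simplex s) = {}"
      using r s by (intro interior_kuhn_simplex_disjoint)
    \<comment> \<open>Translations and injective linear self-maps of the space commute with
      \<open>interior\<close>, so disjointness carries over from the unit cube.\<close>
    moreover have "interior (?F ` A) = ?F ` interior A" for A
      by (simp only: affine_image_eq[OF lin inj] interior_translation
          interior_injective_linear_image[OF lin inj])
    ultimately show ?thesis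
      using r s by (simp add: image_Int[OF \<open>inj ?F\<close>, symmetric])
  qed
  ultimately show ?thesis
    by (intro exI[of _ "(`) ?F ` ?K"] conjI ballI impI)
qed

end
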